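(* Suppose $f:\{-1,1\}^d\to\{-1,1\}$ is symmetric, i.e. $f(u)=f(\pi\cdot u)$ for every permutation $\pi$ of the coordinates. Let $r$ be the number of times $f$ changes signs. Then $\operatorname{thrdeg} f=r$.
   Context: $\operatorname{thrdeg} f$ is the minimal degree of any real polynomial $P$ in $d$ variables such that $0\notin P(\{-1,1\}^d)$ and $\operatorname{sgn}(P)=f$ on $\{-1,1\}^d$. Since $f$ is symmetric, $f(u)=\bar f(s(u))$ for a function $\bar f:\{0,1,\dots,d\}\to\{-1,1\}$, where $s(u)=\sum_i(1-u_i)/2$; the number of times $f$ changes signs is the number of $t\in\{0,\dots,d-1\}$ with $\bar f(t)\neq\bar f(t+1)$. *)

theory Defs
  imports Complex_Main "HOL-Library.FuncSet" "HOL-Library.Poly_Mapping"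
    "HOL-Combinatorics.Permutations"
begin

text \<open>Points of the cube are functions on the index set \<open>{..<d}\<close>, extensional outside it,
  so that distinct functions are distinct points. The dimension \<open>d = 0\<close> is allowed.\<close>

definition cube :: "nat \<Rightarrow> (nat \<Rightarrow> real) set" where
  "cube d = {..<d} \<rightarrow>\<^sub>E {-1, 1}"

text \<open>A real multivariate polynomial is a finitely supported map from monomials to coefficients;
  a monomial is a finitely supported map from variable indices to exponents.\<close>

type_synonym rmpoly = "(nat \<Rightarrow>\<^sub>0 nat) \<Rightarrow>\<^sub>0 real"

definition polys_in :: "nat \<Rightarrow> rmpoly set" where
  "polys_in d = {P. \<forall>m\<in>Poly_Mapping.keys P. Poly_Mapping.keys m \<subseteq> {..<d}}"

definition peval :: "rmpoly \<Rightarrow> (nat \<Rightarrow> real) \<Rightarrow> real" where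
  "peval P x = (\<Sum>m\<in>Poly_Mapping.keys P. Poly_Mapping.lookup P m * (\<Prod>i\<in>Poly_Mapping.keys m. x i ^ Poly_Mapping.lookup m i))"

text \<open>Total degree. The zero polynomial gets degree \<open>0\<close> here, which is harmless below since
  only polynomials that do not vanish on the cube are considered.\<close>

definition pdegree :: "rmpoly \<Rightarrow> nat" where
  "pdegree P = Max (insert 0 ((\<lambda>m. \<Sum>i\<in>Poly_Mapping.keys m. Poly_Mapping.lookup m i) ` Poly_Mapping.keys P))"

definition sign_represents :: "nat \<Rightarrow> rmpoly \<Rightarrow> ((nat \<Rightarrow> real) \<Rightarrow> real) \<Rightarrow> bool" where
  "sign_represents d P f \<longleftrightarrow>
     P \<in> polys_in d \<and> 0 \<notin> peval P ` cube d \<and> (\<forall>u\<in>cube d. sgn (peval P u) = f u)"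

definition thrdeg :: "nat \<Rightarrow> ((nat \<Rightarrow> real) \<Rightarrow> real) \<Rightarrow> nat" where
  "thrdeg d f = (LEAST n. \<exists>P. sign_represents d P f \<and> pdegree P = n)"

definition symmetric_on_cube :: "nat \<Rightarrow> ((nat \<Rightarrow> real) \<Rightarrow> real) \<Rightarrow> bool" where
  "symmetric_on_cube d f \<longleftrightarrow> (\<forall>\<pi> u. \<pi> permutes {..<d} \<longrightarrow> u \<in> cube d \<longrightarrow> f u = f (u \<circ> \<pi>))"

definition neg_count :: "nat \<Rightarrow> (nat \<Rightarrow> real) \<Rightarrow> real" where
  "neg_count d u = (\<Sum>i<d. (1 - u i) / 2)"

text \<open>The function \<open>g : {0, ..., d} \<rightarrow> {-1, 1}\<close> with \<open>f u = g (neg_count d u)\<close> on the cube, which is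
  unique because \<open>neg_count d\<close> maps the cube onto \<open>{0, ..., d}\<close>, and exists if \<open>f\<close> is symmetric
  with values in \<open>{-1, 1}\<close>. The set \<open>{0, ..., d}\<close> is taken as a set of reals because
  \<open>neg_count\<close> is real-valued.\<close>

definition profile :: "nat \<Rightarrow> ((nat \<Rightarrow> real) \<Rightarrow> real) \<Rightarrow> real \<Rightarrow> real" where
  "profile d f = (THE g. g \<in> real ` {0..d} \<rightarrow>\<^sub>E {-1, 1} \<and> (\<forall>u\<in>cube d. f u = g (neg_count d u)))"

definition sign_changes :: "nat \<Rightarrow> ((nat \<Rightarrow> real) \<Rightarrow> real) \<Rightarrow> nat" where
  "sign_changes d f =
     card {t \<in> {0..<d}. profile d f (real t) \<noteq> profile d f (real (t + 1))}"

end

theory Submission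
  imports Defs "HOL-Computational_Algebra.Polynomial"
begin

text \<open>Let \<open>g\<close> be the profile of the symmetric function \<open>f\<close> and \<open>N(u)\<close> the number of coordinates \<open>-1\<close> of
  a vertex \<open>u\<close>, so that \<open>f u = g (N u)\<close>. Both inequalities reduce the problem to univariate
  polynomials in \<open>N\<close>.

  Upper bound (\<open>exists_sign_represents\<close>): \<open>N\<close> is an affine function of \<open>u\<close>, and the product of the
  factors \<open>t + 1/2 - N(u)\<close> over all \<open>t\<close> with \<open>g t \<noteq> g (t + 1)\<close> has one factor per sign change. As
  \<open>N\<close> moves from \<open>k\<close> to \<open>k + 1\<close> only the factor with \<open>t = k\<close> can change sign, hence the product times
  \<open>g 0\<close> has the sign of \<open>g\<close> everywhere.

  Lower bound (\<open>sign_changes_le_pdegree\<close>): sum a sign-representing polynomial \<open>P\<close> over all vertices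
  with \<open>N(u) = t\<close>. No cancellation occurs, because \<open>P\<close> has the constant sign \<open>g t\<close> there. By
  \<open>layer_sum_peval\<close> (the symmetrisation argument of Minsky and Papert) the average over this layer
  is \<open>q t\<close> for a univariate polynomial \<open>q\<close> with degree at most that of \<open>P\<close>. Each sign change
  of \<open>g\<close> then gives a root of \<open>q\<close> in the open interval from \<open>t\<close> to \<open>t + 1\<close>, and \<open>q\<close> has at most
  \<open>degree q\<close> roots.\<close>

section \<open>Evaluation and degree of multivariate polynomials\<close>

definition mono_eval :: "(nat \<Rightarrow>\<^sub>0 nat) \<Rightarrow> (nat \<Rightarrow> real) \<Rightarrow> real" where
  "mono_eval m x = (\<Prod>i\<in>Poly_Mapping.keys m. x i ^ Poly_Mapping.lookup m i)"

definition mono_degree :: "(nat \<Rightarrow>\<^sub>0 nat) \<Rightarrow> nat" where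
  "mono_degree m = (\<Sum>i\<in>Poly_Mapping.keys m. Poly_Mapping.lookup m i)"

text \<open>The support of a sum of monomials can differ from the supports of the summands. Extending the
  products and sums to a common finite index set makes them comparable; \<open>peval_superset\<close> does the
  same for the monomials of a polynomial.\<close>

lemma mono_eval_superset:
  assumes "finite K" "Poly_Mapping.keys m \<subseteq> K"
  shows "mono_eval m x = (\<Prod>i\<in>K. x i ^ Poly_Mapping.lookup m i)"
  unfolding mono_eval_def
  by (rule prod.mono_neutral_left) (use assms in \<open>auto simp: in_keys_iff\<close>)

lemma mono_degree_superset:
  assumes "finite K" "Poly_Mapping.keys m \<subseteq> K"
  shows "mono_degree m = (\<Sum>i\<in>K. Poly_Mapping.lookup m i)"
  unfolding mono_degree_def
  by (rule sum.mono_neutral_left) (use assms in \<open>auto simp: in_keys_iff\<close>)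

lemma mono_eval_add: "mono_eval (m + m') x = mono_eval m x * mono_eval m' x"
proof -
  let ?K = "Poly_Mapping.keys m \<union> Poly_Mapping.keys m'"
  have K: "finite ?K" "Poly_Mapping.keys (m + m') \<subseteq> ?K"
    using keys_add[of m m'] by auto
  show ?thesis
    using mono_eval_superset[OF K] mono_eval_superset[OF K(1), of m]
      mono_eval_superset[OF K(1), of m']
    by (simp add: lookup_add power_add prod.distrib)
qed

lemma mono_degree_add: "mono_degree (m + m') = mono_degree m + mono_degree m'"
proof -
  let ?K = "Poly_Mapping.keys m \<union> Poly_Mapping.keys m'"
  have K: "finite ?K" "Poly_Mapping.keys (m + m') \<subseteq> ?K"
    using keys_add[of m m'] by auto
  show ?thesis
    using mono_degree_superset[OF K] mono_degree_superset[OF K(1), of m]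
      mono_degree_superset[OF K(1), of m']
    by (simp add: lookup_add sum.distrib)
qed

lemma peval_superset:
  assumes "finite K" "Poly_Mapping.keys P \<subseteq> K"
  shows "peval P x = (\<Sum>m\<in>K. Poly_Mapping.lookup P m * mono_eval m x)"
  unfolding peval_def mono_eval_def[symmetric]
  by (rule sum.mono_neutral_left) (use assms in \<open>auto simp: in_keys_iff\<close>)

lemma peval_zero [simp]: "peval 0 x = 0"
  by (simp add: peval_def)

lemma peval_single [simp]: "peval (Poly_Mapping.single m c) x = c * mono_eval m x"
  by (simp add: peval_def mono_eval_def)

lemma peval_add: "peval (P + Q) x = peval P x + peval Q x"
proof -
  let ?K = "Poly_Mapping.keys P \<union> Poly_Mapping.keys Q"
  have K: "finite ?K" "Poly_Mapping.keys (P + Q) \<subseteq> ?K"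
    using keys_add[of P Q] by auto
  show ?thesis
    using peval_superset[OF K] peval_superset[OF K(1), of P] peval_superset[OF K(1), of Q]
    by (simp add: lookup_add sum.distrib ring_distribs)
qed

lemma peval_sum: "peval (\<Sum>i\<in>I. F i) x = (\<Sum>i\<in>I. peval (F i) x)"
  by (induction I rule: infinite_finite_induct) (simp_all add: peval_add)

lemma rmpoly_eq_sum_single:
  "P = (\<Sum>m\<in>Poly_Mapping.keys P. Poly_Mapping.single m (Poly_Mapping.lookup P m))"
  for P :: rmpoly
  by (rule poly_mapping_eqI) (auto simp: lookup_sum lookup_single when_def in_keys_iff sum.delta)

lemma peval_mult: "peval (P * Q) x = peval P x * peval Q x"
proof -
  have "peval (P * Q) x =
      peval ((\<Sum>m\<in>Poly_Mapping.keys P. Poly_Mapping.single m (Poly_Mapping.lookup P m)) *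
        (\<Sum>m\<in>Poly_Mapping.keys Q. Poly_Mapping.single m (Poly_Mapping.lookup Q m))) x"
    using rmpoly_eq_sum_single[of P] rmpoly_eq_sum_single[of Q] by simp
  also have "\<dots> = peval P x * peval Q x"
    by (simp add: sum_product mult_single peval_sum mono_eval_add peval_superset[OF _ order_refl]
        algebra_simps)
  finally show ?thesis .
qed

lemma pdegree_le_iff: "pdegree P \<le> n \<longleftrightarrow> (\<forall>m\<in>Poly_Mapping.keys P. mono_degree m \<le> n)"
  by (simp add: pdegree_def mono_degree_def)

lemma mono_degree_le_pdegree: "m \<in> Poly_Mapping.keys P \<Longrightarrow> mono_degree m \<le> pdegree P"
  using pdegree_le_iff by blast

lemma pdegree_mult_le: "pdegree (P * Q) \<le> pdegree P + pdegree Q"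
  unfolding pdegree_le_iff
proof
  fix m assume "m \<in> Poly_Mapping.keys (P * Q)"
  then obtain a b where "m = a + b" "a \<in> Poly_Mapping.keys P" "b \<in> Poly_Mapping.keys Q"
    using keys_mult[of P Q] by blast
  then show "mono_degree m \<le> pdegree P + pdegree Q"
    by (simp add: mono_degree_add add_mono mono_degree_le_pdegree)
qed

lemma polys_in_mult:
  assumes "P \<in> polys_in d" "Q \<in> polys_in d"
  shows "P * Q \<in> polys_in d"
  unfolding polys_in_def
proof (intro CollectI ballI)
  fix m assume "m \<in> Poly_Mapping.keys (P * Q)"
  then obtain a b where "m = a + b" "a \<in> Poly_Mapping.keys P" "b \<in> Poly_Mapping.keys Q"
    using keys_mult[of P Q] by blast
  then show "Poly_Mapping.keys m \<subseteq> {..<d}"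
    using assms keys_add[of a b] unfolding polys_in_def by blast
qed

text \<open>The degree-one building block: \<open>a - N(u) = (a - d/2) + (u\<^sub>0 + \<dots> + u\<^bsub>d-1\<^esub>) / 2\<close>.\<close>

lemma exists_poly_minus_neg_count:
  "\<exists>P\<in>polys_in d. pdegree P \<le> 1 \<and> (\<forall>u. peval P u = a - neg_count d u)"
proof -
  define S where "S = (\<Sum>i<d. Poly_Mapping.single (Poly_Mapping.single i (1::nat)) (1 / 2 :: real))"
  define P where "P = Poly_Mapping.single 0 (a - real d / 2) + S"
  have keys_S: "Poly_Mapping.keys S \<subseteq> (\<lambda>i. Poly_Mapping.single i 1) ` {..<d}"
    unfolding S_def using keys_sum by fastforce
  have keys_P: "Poly_Mapping.keys P \<subseteq> insert 0 ((\<lambda>i. Poly_Mapping.single i 1) ` {..<d})"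
    unfolding P_def using keys_S keys_add[of "Poly_Mapping.single 0 (a - real d / 2)" S]
    by (auto split: if_splits)
  have "P \<in> polys_in d"
    using keys_P by (force simp: polys_in_def)
  moreover have "pdegree P \<le> 1"
    using keys_P by (auto simp: pdegree_le_iff mono_degree_def)
  moreover have "peval P u = a - neg_count d u" for u
    by (simp add: P_def S_def peval_add peval_sum mono_eval_def neg_count_def
        diff_divide_distrib sum_subtractf)
  ultimately show ?thesis by blast
qed

lemma exists_poly_prod_minus_neg_count:
  assumes "finite T"
  shows "\<exists>P\<in>polys_in d. pdegree P \<le> card T \<and>
    (\<forall>u. peval P u = c * (\<Prod>t\<in>T. a t - neg_count d u))"
  using assms
proof (induction T)
  case empty
  show ?case
    by (rule bexI[of _ "Poly_Mapping.single 0 c"])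
      (auto simp: polys_in_def pdegree_def mono_eval_def)
next
  case (insert s T)
  from insert.IH obtain P where P: "P \<in> polys_in d" "pdegree P \<le> card T"
    "\<And>u. peval P u = c * (\<Prod>t\<in>T. a t - neg_count d u)" by blast
  obtain L where L: "L \<in> polys_in d" "pdegree L \<le> 1" "\<And>u. peval L u = a s - neg_count d u"
    using exists_poly_minus_neg_count by blast
  have "pdegree (L * P) \<le> card (insert s T)"
    using pdegree_mult_le[of L P] P(2) L(2) insert.hyps by simp
  moreover have "peval (L * P) u = c * (\<Prod>t\<in>insert s T. a t - neg_count d u)" for u
    using insert.hyps by (simp add: peval_mult P(3) L(3))
  ultimately show ?case
    using polys_in_mult[OF L(1) P(1)] by blast
qed

section \<open>Vertices of the cube and the profile of a symmetric function\<close>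

text \<open>The vertices of the cube are identified with the subsets \<open>A\<close> of \<open>{..<d}\<close> of coordinates equal to
  \<open>-1\<close>. The value of \<open>neg_count\<close> becomes \<open>card A\<close>, and its level sets become the layers of the
  subset lattice.\<close>

definition vertex :: "nat \<Rightarrow> nat set \<Rightarrow> nat \<Rightarrow> real" where
  "vertex d A = (\<lambda>i\<in>{..<d}. if i \<in> A then -1 else 1)"

definition layer :: "nat \<Rightarrow> nat \<Rightarrow> nat set set" where
  "layer d t = {A. A \<subseteq> {..<d} \<and> card A = t}"

lemma finite_layer [simp]: "finite (layer d t)"
  by (rule finite_subset[of _ "Pow {..<d}"]) (auto simp: layer_def)

lemma card_layer: "card (layer d t) = d choose t"
  using n_subsets[of "{..<d}" t] by (simp add: layer_def)

lemma vertex_in_cube: "vertex d A \<in> cube d"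
  by (auto simp: vertex_def cube_def)

lemma neg_count_vertex:
  assumes "A \<subseteq> {..<d}"
  shows "neg_count d (vertex d A) = real (card A)"
proof -
  have "neg_count d (vertex d A) = (\<Sum>i<d. if i \<in> A then 1 else 0)"
    unfolding neg_count_def by (rule sum.cong) (auto simp: vertex_def)
  also have "\<dots> = real (card ({..<d} \<inter> A))"
    by (simp add: sum.If_cases)
  finally show ?thesis
    using assms by (simp add: Int_absorb1)
qed

lemma cube_eq_vertex:
  assumes "u \<in> cube d"
  obtains A where "A \<subseteq> {..<d}" "u = vertex d A"
proof
  show "{i\<in>{..<d}. u i = -1} \<subseteq> {..<d}" by auto
  show "u = vertex d {i\<in>{..<d}. u i = -1}"
    using assms by (fastforce simp: vertex_def cube_def restrict_def PiE_iff extensional_def)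
qed

text \<open>Two subsets of equal size have complements of equal size, so bijections between the subsets and
  between the complements glue to a permutation. In other words, permutations act transitively on
  each layer, which is why a symmetric function depends on \<open>card A\<close> only.\<close>

lemma ex_permutes_image_eq:
  assumes "finite S" "A \<subseteq> S" "B \<subseteq> S" "card A = card B"
  obtains \<pi> where "\<pi> permutes S" "\<And>i. i \<in> S \<Longrightarrow> \<pi> i \<in> B \<longleftrightarrow> i \<in> A"
proof -
  have fin: "finite A" "finite B" "finite (S - A)" "finite (S - B)"
    using assms finite_subset by auto
  obtain g where g: "bij_betw g A B"
    using fin assms finite_same_card_bij by blast
  have "card (S - A) = card (S - B)"
    using assms fin by (simp add: card_Diff_subset)
  then obtain h where h: "bij_betw h (S - A) (S - B)"
    using fin finite_same_card_bij by blast
  define \<pi> where "\<pi> i = (if i \<in> A then g i else if i \<in> S then h i else i)" for i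
  have "bij_betw \<pi> A B"
    using g by (rule bij_betw_cong[THEN iffD1, rotated]) (simp add: \<pi>_def)
  moreover have "bij_betw \<pi> (S - A) (S - B)"
    using h by (rule bij_betw_cong[THEN iffD1, rotated]) (simp add: \<pi>_def)
  ultimately have "bij_betw \<pi> (A \<union> (S - A)) (B \<union> (S - B))"
    by (rule bij_betw_combine) auto
  then have "bij_betw \<pi> S S"
    using assms by (simp add: Un_absorb1)
  then have "\<pi> permutes S"
    by (rule bij_imp_permutes) (use assms in \<open>auto simp: \<pi>_def\<close>)
  moreover have "\<pi> i \<in> B \<longleftrightarrow> i \<in> A" if "i \<in> S" for i
    using g h that by (auto simp: \<pi>_def bij_betw_def)
  ultimately show ?thesis using that by blast
qed

lemma symmetric_on_cube_vertex_eq: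
  assumes "symmetric_on_cube d f" "A \<subseteq> {..<d}" "B \<subseteq> {..<d}" "card A = card B"
  shows "f (vertex d A) = f (vertex d B)"
proof -
  obtain \<pi> where \<pi>: "\<pi> permutes {..<d}" "\<And>i. i \<in> {..<d} \<Longrightarrow> \<pi> i \<in> B \<longleftrightarrow> i \<in> A"
    using ex_permutes_image_eq[of "{..<d}" A B] assms by auto
  have "vertex d B \<circ> \<pi> = vertex d A"
    using \<pi> permutes_in_image[OF \<pi>(1)] by (fastforce simp: vertex_def fun_eq_iff)
  then show ?thesis
    using assms(1) \<pi>(1) vertex_in_cube unfolding symmetric_on_cube_def by metis
qed

text \<open>This unfolds the definite description in \<open>profile\<close>. Existence is witnessed by evaluating \<open>f\<close> at the
  initial segments \<open>{..<k}\<close>, and uniqueness holds because every \<open>k \<le> d\<close> is the size of such a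
  segment.\<close>

lemma profile_vertex:
  assumes "f \<in> cube d \<rightarrow> {-1, 1}" "symmetric_on_cube d f" "A \<subseteq> {..<d}"
  shows "profile d f (real (card A)) = f (vertex d A)"
proof -
  have card_le: "card A \<le> d" if "A \<subseteq> {..<d}" for A :: "nat set"
    using card_mono[OF _ that] by simp
  define Q where "Q g \<longleftrightarrow> g \<in> real ` {0..d} \<rightarrow>\<^sub>E {-1, 1} \<and> (\<forall>u\<in>cube d. f u = g (neg_count d u))"
    for g :: "real \<Rightarrow> real"
  define g where "g = (\<lambda>x\<in>real ` {0..d}. f (vertex d {..<nat \<lfloor>x\<rfloor>}))"
  have g: "Q g"
    unfolding Q_def
  proof (intro conjI ballI)
    show "g \<in> real ` {0..d} \<rightarrow>\<^sub>E {-1, 1}"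
      using assms(1) vertex_in_cube by (fastforce simp: g_def)
    fix u assume "u \<in> cube d"
    then obtain A where A: "A \<subseteq> {..<d}" "u = vertex d A" by (rule cube_eq_vertex)
    then have "f u = f (vertex d {..<card A})"
      using symmetric_on_cube_vertex_eq[OF assms(2) A(1), of "{..<card A}"] card_le[OF A(1)] by auto
    then show "f u = g (neg_count d u)"
      using A card_le[OF A(1)] by (auto simp: neg_count_vertex g_def)
  qed
  have at_vertex: "h (real (card A)) = f (vertex d A)" if "Q h" "A \<subseteq> {..<d}" for h A
    using that vertex_in_cube neg_count_vertex unfolding Q_def by metis
  have "h = g" if "Q h" for h
  proof (rule PiE_ext)
    show "h \<in> real ` {0..d} \<rightarrow>\<^sub>E {-1, 1}" "g \<in> real ` {0..d} \<rightarrow>\<^sub>E {-1, 1}"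
      using that g by (simp_all add: Q_def)
    fix x assume "x \<in> real ` {0..d}"
    then obtain k where k: "x = real k" "k \<le> d" by auto
    then show "h x = g x"
      using at_vertex[OF that, of "{..<k}"] at_vertex[OF g, of "{..<k}"] by auto
  qed
  then have "profile d f = g"
    unfolding profile_def Q_def[symmetric] using g by blast
  then show ?thesis
    using at_vertex[OF g assms(3)] by simp
qed

lemma profile_values:
  assumes "f \<in> cube d \<rightarrow> {-1, 1}" "symmetric_on_cube d f" "k \<le> d"
  shows "profile d f (real k) = 1 \<or> profile d f (real k) = -1"
  using profile_vertex[OF assms(1,2), of "{..<k}"] assms(1,3) vertex_in_cube[of d "{..<k}"]
  by fastforce

section \<open>Averaging a polynomial over the layers of the cube\<close>

text \<open>The polynomial \<open>x (x - 1) \<dots> (x - s + 1) / s!\<close>, which interpolates the binomial coefficients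
  \<open>t choose s\<close>.\<close>

definition binomial_poly :: "nat \<Rightarrow> real poly" where
  "binomial_poly s = smult (1 / fact s) (\<Prod>i<s. [:- real i, 1:])"

lemma poly_binomial_poly: "poly (binomial_poly s) (real t) = real (t choose s)"
  by (simp add: binomial_poly_def poly_prod binomial_gbinomial gbinomial_prod_rev atLeast0LessThan)

lemma degree_binomial_poly_le: "degree (binomial_poly s) \<le> s"
proof -
  have "degree (\<Prod>i<s. [:- real i, 1:]) \<le> s"
    using degree_prod_sum_le[of "{..<s}" "\<lambda>i. [:- real i, 1:]"] by simp
  then show ?thesis
    unfolding binomial_poly_def using degree_smult_le order_trans by blast
qed

text \<open>Removing \<open>T\<close> from \<open>A\<close> shows that the number of \<open>t\<close>-subsets \<open>A\<close> containing \<open>T\<close> is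
  \<open>(d - s) choose (t - s)\<close> with \<open>s = card T\<close>. The quotient form on the right exhibits the fraction of
  the layer occupied by these sets as a multiple of \<open>t choose s\<close>, a polynomial in \<open>t\<close> of degree
  \<open>s\<close>; it also covers \<open>t < s\<close>, where both sides vanish.\<close>

lemma card_layer_superset:
  assumes "T \<subseteq> {..<d}"
  shows "real (card {A\<in>layer d t. T \<subseteq> A}) =
    real (d choose t) * real (t choose card T) / real (d choose card T)"
proof -
  have fT: "finite T" and Td: "card T \<le> d"
    using assms finite_subset card_mono[OF _ assms] by auto
  have pos: "d choose card T > 0"
    using Td by simp
  show ?thesis
  proof (cases "card T \<le> t \<and> t \<le> d")
    case True
    have "bij_betw (\<lambda>A. A - T) {A\<in>layer d t. T \<subseteq> A} {B. B \<subseteq> {..<d} - T \<and> card B = t - card T}"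
    proof (rule bij_betw_byWitness[where f' = "\<lambda>B. B \<union> T"])
      show "(\<lambda>A. A - T) ` {A\<in>layer d t. T \<subseteq> A} \<subseteq> {B. B \<subseteq> {..<d} - T \<and> card B = t - card T}"
        using fT by (auto simp: layer_def card_Diff_subset)
      show "(\<lambda>B. B \<union> T) ` {B. B \<subseteq> {..<d} - T \<and> card B = t - card T} \<subseteq> {A\<in>layer d t. T \<subseteq> A}"
      proof (clarsimp simp: layer_def assms)
        fix B assume B: "B \<subseteq> {..<d} - T" "card B = t - card T"
        then have "finite B" "B \<inter> T = {}" using finite_subset by auto
        then show "B \<subseteq> {..<d} \<and> card (B \<union> T) = t"
          using B True fT by (auto simp: card_Un_disjoint)
      qed
    qed auto
    then have "card {A\<in>layer d t. T \<subseteq> A} = card {B. B \<subseteq> {..<d} - T \<and> card B = t - card T}"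
      by (rule bij_betw_same_card)
    also have "\<dots> = (d - card T) choose (t - card T)"
      using n_subsets[of "{..<d} - T" "t - card T"] fT assms by (simp add: card_Diff_subset)
    finally have "(d choose card T) * card {A\<in>layer d t. T \<subseteq> A} = (d choose t) * (t choose card T)"
      using choose_mult[of "card T" t d] True by simp
    then have "real (d choose card T) * real (card {A\<in>layer d t. T \<subseteq> A})
        = real (d choose t) * real (t choose card T)"
      by (metis of_nat_mult)
    then show ?thesis
      using pos by (simp add: field_simps)
  next
    case False
    have "{A\<in>layer d t. T \<subseteq> A} = {}"
    proof (rule ccontr)
      assume "{A\<in>layer d t. T \<subseteq> A} \<noteq> {}"
      then obtain A where A: "A \<subseteq> {..<d}" "card A = t" "T \<subseteq> A"
        by (auto simp: layer_def)
      then show False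
        using False card_mono[OF _ A(1)] card_mono[OF _ A(3)] finite_subset by fastforce
    qed
    then show ?thesis
      using False by (auto simp: binomial_eq_0)
  qed
qed

text \<open>Since \<open>u\<^sub>i\<close> is \<open>1\<close> or \<open>-1\<close>, only the parity of an exponent matters, and \<open>u\<^sub>i = 1 - 2 x\<^sub>i\<close> where
  \<open>x\<^sub>i\<close> indicates \<open>i \<in> A\<close>. Multiplying out expresses the monomial through the indicators
  of \<open>T \<subseteq> A\<close>, whose layer sums are known.\<close>

lemma mono_eval_vertex:
  assumes "Poly_Mapping.keys m \<subseteq> {..<d}"
  shows "mono_eval m (vertex d A) =
    (\<Sum>T\<in>Pow {i\<in>Poly_Mapping.keys m. odd (Poly_Mapping.lookup m i)}. (-2) ^ card T * of_bool (T \<subseteq> A))"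
proof -
  let ?S = "{i\<in>Poly_Mapping.keys m. odd (Poly_Mapping.lookup m i)}"
  have "mono_eval m (vertex d A) = (\<Prod>i\<in>Poly_Mapping.keys m. if odd (Poly_Mapping.lookup m i)
      then (if i \<in> A then -2 else 0) + 1 else 1)"
    unfolding mono_eval_def by (rule prod.cong) (use assms in \<open>auto simp: vertex_def\<close>)
  also have "\<dots> = (\<Prod>i\<in>?S. (if i \<in> A then -2 else 0) + 1)"
    by (rule prod.inter_filter[symmetric]) simp
  also have "\<dots> = (\<Sum>T\<in>Pow ?S. \<Prod>i\<in>T. if i \<in> A then -2 else 0)"
    by (subst prod_add) auto
  also have "\<dots> = (\<Sum>T\<in>Pow ?S. (-2) ^ card T * of_bool (T \<subseteq> A))"
  proof (rule sum.cong)
    fix T assume "T \<in> Pow ?S"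
    then have "finite T" by (auto intro: finite_subset[OF _ finite_keys[of m]])
    then show "(\<Prod>i\<in>T. if i \<in> A then -2 else 0) = (-2) ^ card T * (of_bool (T \<subseteq> A) :: real)"
      by (cases "T \<subseteq> A") (auto simp: subset_iff intro!: prod_zero)
  qed simp
  finally show ?thesis .
qed

lemma layer_sum_mono_eval:
  assumes "Poly_Mapping.keys m \<subseteq> {..<d}"
  obtains p where "degree p \<le> mono_degree m"
    "\<And>t. (\<Sum>A\<in>layer d t. mono_eval m (vertex d A)) = real (d choose t) * poly p (real t)"
proof
  let ?S = "{i\<in>Poly_Mapping.keys m. odd (Poly_Mapping.lookup m i)}"
  let ?p = "\<Sum>T\<in>Pow ?S. smult ((-2) ^ card T / real (d choose card T)) (binomial_poly (card T))"
  show "degree ?p \<le> mono_degree m"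
  proof (rule degree_sum_le)
    fix T assume T: "T \<in> Pow ?S"
    \<comment> \<open>every variable with an odd exponent contributes at least \<open>1\<close> to the degree\<close>
    have "card T = (\<Sum>i\<in>T. 1)" by simp
    also have "\<dots> \<le> (\<Sum>i\<in>T. Poly_Mapping.lookup m i)"
      by (rule sum_mono) (use T in \<open>auto simp: in_keys_iff Suc_le_eq\<close>)
    also have "\<dots> \<le> mono_degree m"
      unfolding mono_degree_def by (rule sum_mono2) (use T in auto)
    finally show "degree (smult ((-2) ^ card T / real (d choose card T)) (binomial_poly (card T)))
        \<le> mono_degree m"
      using degree_binomial_poly_le degree_smult_le order_trans by meson
  qed simp
  fix t
  have "(\<Sum>A\<in>layer d t. mono_eval m (vertex d A)) =
      (\<Sum>T\<in>Pow ?S. \<Sum>A\<in>layer d t. (-2) ^ card T * of_bool (T \<subseteq> A))"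
    unfolding mono_eval_vertex[OF assms] by (rule sum.swap)
  also have "\<dots> = (\<Sum>T\<in>Pow ?S. (-2) ^ card T * real (card {A\<in>layer d t. T \<subseteq> A}))"
    by (simp add: sum_distrib_left[symmetric] of_bool_def sum.If_cases Int_def)
  also have "\<dots> = real (d choose t) * poly ?p (real t)"
    unfolding poly_sum sum_distrib_left
  proof (rule sum.cong)
    fix T assume "T \<in> Pow ?S"
    then have "T \<subseteq> {..<d}" using assms by auto
    then show "(-2) ^ card T * real (card {A\<in>layer d t. T \<subseteq> A}) = real (d choose t) *
        poly (smult ((-2) ^ card T / real (d choose card T)) (binomial_poly (card T))) (real t)"
      by (simp add: card_layer_superset poly_binomial_poly)
  qed simp
  finally show "(\<Sum>A\<in>layer d t. mono_eval m (vertex d A)) = real (d choose t) * poly ?p (real t)" .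
qed

text \<open>Symmetrisation: the average of \<open>P\<close> over a layer is a univariate polynomial in the index of the
  layer, and averaging does not raise the degree. By linearity this follows from the case of a
  monomial.\<close>

lemma layer_sum_peval:
  assumes "P \<in> polys_in d"
  obtains q where "degree q \<le> pdegree P"
    "\<And>t. (\<Sum>A\<in>layer d t. peval P (vertex d A)) = real (d choose t) * poly q (real t)"
proof -
  have "\<forall>m\<in>Poly_Mapping.keys P. \<exists>p. degree p \<le> mono_degree m \<and>
      (\<forall>t. (\<Sum>A\<in>layer d t. mono_eval m (vertex d A)) = real (d choose t) * poly p (real t))"
  proof
    fix m assume "m \<in> Poly_Mapping.keys P"
    then have "Poly_Mapping.keys m \<subseteq> {..<d}"
      using assms by (simp add: polys_in_def)
    from layer_sum_mono_eval[OF this] show "\<exists>p. degree p \<le> mono_degree m \<and>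
        (\<forall>t. (\<Sum>A\<in>layer d t. mono_eval m (vertex d A)) = real (d choose t) * poly p (real t))"
      by metis
  qed
  then obtain p where p: "\<And>m. m \<in> Poly_Mapping.keys P \<Longrightarrow> degree (p m) \<le> mono_degree m"
    "\<And>m t. m \<in> Poly_Mapping.keys P \<Longrightarrow>
      (\<Sum>A\<in>layer d t. mono_eval m (vertex d A)) = real (d choose t) * poly (p m) (real t)"
    by metis
  let ?q = "\<Sum>m\<in>Poly_Mapping.keys P. smult (Poly_Mapping.lookup P m) (p m)"
  have "degree ?q \<le> pdegree P"
  proof (rule degree_sum_le)
    fix m assume m: "m \<in> Poly_Mapping.keys P"
    show "degree (smult (Poly_Mapping.lookup P m) (p m)) \<le> pdegree P"
      using degree_smult_le p(1)[OF m] mono_degree_le_pdegree[OF m] order_trans by meson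
  qed simp
  moreover have "(\<Sum>A\<in>layer d t. peval P (vertex d A)) = real (d choose t) * poly ?q (real t)" for t
  proof -
    have "(\<Sum>A\<in>layer d t. peval P (vertex d A)) = (\<Sum>m\<in>Poly_Mapping.keys P.
        Poly_Mapping.lookup P m * (\<Sum>A\<in>layer d t. mono_eval m (vertex d A)))"
      unfolding peval_superset[OF finite_keys order_refl] sum_distrib_left by (rule sum.swap)
    then show ?thesis
      by (simp add: p(2) poly_sum sum_distrib_left algebra_simps)
  qed
  ultimately show ?thesis using that by blast
qed

section \<open>Sign changes bound the degree, and are attained\<close>

text \<open>The intermediate value theorem puts a root strictly between \<open>t\<close> and \<open>t + 1\<close> for each counted \<open>t\<close>;
  these roots are distinct because the open intervals are disjoint.\<close>

lemma card_sign_changes_le_degree: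
  fixes q :: "real poly"
  assumes "q \<noteq> 0"
  shows "card {t\<in>{0..<d}. poly q (real t) * poly q (real (t + 1)) < 0} \<le> degree q"
proof -
  let ?T = "{t\<in>{0..<d}. poly q (real t) * poly q (real (t + 1)) < 0}"
  have "\<forall>t\<in>?T. \<exists>x>real t. x < real (t + 1) \<and> poly q x = 0"
    using poly_IVT by auto
  then obtain z where z: "\<And>t. t \<in> ?T \<Longrightarrow> real t < z t \<and> z t < real (t + 1) \<and> poly q (z t) = 0"
    by metis
  have "inj_on z ?T"
  proof (rule inj_onI)
    fix s t assume "s \<in> ?T" "t \<in> ?T" "z s = z t"
    then have "real s < real (t + 1)" "real t < real (s + 1)"
      using z[of s] z[of t] by linarith+
    then show "s = t" by linarith
  qed
  then have "card ?T \<le> card {x. poly q x = 0}"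
    by (rule card_inj_on_le) (use z poly_roots_finite[OF assms] in auto)
  also have "\<dots> \<le> degree q"
    using assms by (rule card_poly_roots_bound)
  finally show ?thesis .
qed

lemma sign_changes_le_pdegree:
  assumes f: "f \<in> cube d \<rightarrow> {-1, 1}" "symmetric_on_cube d f"
    and P: "sign_represents d P f"
  shows "sign_changes d f \<le> pdegree P"
proof -
  obtain q where q: "degree q \<le> pdegree P"
    "\<And>t. (\<Sum>A\<in>layer d t. peval P (vertex d A)) = real (d choose t) * poly q (real t)"
    using P layer_sum_peval unfolding sign_represents_def by blast
  have sgn_q: "sgn (poly q (real t)) = profile d f (real t)" if "t \<le> d" for t
  proof -
    let ?c = "profile d f (real t)"
    have ne: "layer d t \<noteq> {}"
      using that card_layer[of d t] by (metis card.empty zero_less_binomial less_irrefl)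
    have vals: "?c = 1 \<or> ?c = -1"
      using profile_values[OF f that] .
    \<comment> \<open>all terms of the layer sum have the sign \<open>?c\<close>, hence so does the sum\<close>
    have "?c * peval P (vertex d A) > 0" if "A \<in> layer d t" for A
    proof -
      have "sgn (peval P (vertex d A)) = ?c"
        using P that profile_vertex[OF f, of A] vertex_in_cube
        unfolding sign_represents_def layer_def by auto
      then have "?c * peval P (vertex d A) = \<bar>peval P (vertex d A)\<bar>" "peval P (vertex d A) \<noteq> 0"
        using vals by (auto simp: abs_sgn)
      then show ?thesis
        by simp
    qed
    then have "(\<Sum>A\<in>layer d t. ?c * peval P (vertex d A)) > 0"
      using ne by (intro sum_pos) auto
    then have "real (d choose t) * (?c * poly q (real t)) > 0"
      using q(2)[of t] by (simp add: sum_distrib_left[symmetric] mult.left_commute)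
    then have "?c * poly q (real t) > 0"
      by (simp add: zero_less_mult_iff)
    then show ?thesis
      using vals by (auto simp: sgn_if)
  qed
  have "q \<noteq> 0"
    using sgn_q[of 0] profile_values[OF f, of 0] by auto
  have "{t \<in> {0..<d}. profile d f (real t) \<noteq> profile d f (real (t + 1))}
      \<subseteq> {t\<in>{0..<d}. poly q (real t) * poly q (real (t + 1)) < 0}"
  proof clarify
    fix t assume t: "t \<in> {0..<d}" and ne: "profile d f (real t) \<noteq> profile d f (real (t + 1))"
    then have "sgn (poly q (real t)) \<noteq> sgn (poly q (real (t + 1)))"
      "sgn (poly q (real t)) \<noteq> 0" "sgn (poly q (real (t + 1))) \<noteq> 0"
      using sgn_q[of t] sgn_q[of "t + 1"] profile_values[OF f, of t]
        profile_values[OF f, of "t + 1"] by auto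
    then show "poly q (real t) * poly q (real (t + 1)) < 0"
      by (auto simp: sgn_if mult_less_0_iff split: if_splits)
  qed
  then have "sign_changes d f \<le> card {t\<in>{0..<d}. poly q (real t) * poly q (real (t + 1)) < 0}"
    unfolding sign_changes_def by (intro card_mono) auto
  then show ?thesis
    using card_sign_changes_le_degree[OF \<open>q \<noteq> 0\<close>, of d] q(1) by linarith
qed

lemma sgn_prod: "sgn (\<Prod>i\<in>I. h i) = (\<Prod>i\<in>I. sgn (h i))" for h :: "'a \<Rightarrow> real"
  by (induction I rule: infinite_finite_induct) (simp_all add: sgn_mult)

text \<open>Passing from \<open>k\<close> to \<open>k + 1\<close> flips the sign of the factor with \<open>t = k\<close> and of no other. That factor
  is present exactly if \<open>g k \<noteq> g (k + 1)\<close>, so product and \<open>g\<close> change sign together. The shift by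
  \<open>1/2\<close> keeps all factors nonzero at integers, and \<open>g 0\<close> corrects the sign at \<open>k = 0\<close>, where all
  factors are positive.\<close>

lemma sgn_prod_half_integers:
  fixes g :: "nat \<Rightarrow> real"
  assumes vals: "\<And>k. k \<le> d \<Longrightarrow> g k = 1 \<or> g k = -1" and "k \<le> d"
  shows "sgn (g 0 * (\<Prod>t | t < d \<and> g t \<noteq> g (t + 1). real t + 1 / 2 - real k)) = g k"
  using \<open>k \<le> d\<close>
proof (induction k)
  case 0
  have "(\<Prod>t | t < d \<and> g t \<noteq> g (t + 1). real t + 1 / 2 - real 0) > 0"
    by (rule prod_pos) auto
  then show ?case
    using vals[of 0] by (auto simp: sgn_mult)
next
  case (Suc k)
  let ?T = "{t. t < d \<and> g t \<noteq> g (t + 1)}"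
  have sgn_factor: "sgn (real t + 1 / 2 - real (Suc k)) =
      (if t = k then -1 else 1) * sgn (real t + 1 / 2 - real k)" for t
  proof -
    consider "t < k" | "t = k" | "t > k" by linarith
    then show ?thesis
    proof cases
      case 1
      then have "real t + 1 / 2 - real (Suc k) < 0" "real t + 1 / 2 - real k < 0" by linarith+
      then show ?thesis using 1 by simp
    next
      case 3
      then have "real t + 1 / 2 - real (Suc k) > 0" "real t + 1 / 2 - real k > 0" by linarith+
      then show ?thesis using 3 by simp
    qed simp
  qed
  have "sgn (g 0 * (\<Prod>t\<in>?T. real t + 1 / 2 - real (Suc k))) =
      sgn (g 0) * ((\<Prod>t\<in>?T. if t = k then -1 else 1) * (\<Prod>t\<in>?T. sgn (real t + 1 / 2 - real k)))"
    unfolding sgn_mult sgn_prod sgn_factor prod.distrib ..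
  also have "\<dots> = (if k \<in> ?T then -1 else 1) * g k"
    using Suc by (simp add: sgn_mult sgn_prod prod.delta algebra_simps)
  also have "\<dots> = g (Suc k)"
    using vals[of k] vals[of "Suc k"] Suc.prems by auto
  finally show ?case .
qed

lemma exists_sign_represents:
  assumes f: "f \<in> cube d \<rightarrow> {-1, 1}" "symmetric_on_cube d f"
  obtains P where "sign_represents d P f" "pdegree P \<le> sign_changes d f"
proof -
  define g where "g k = profile d f (real k)" for k :: nat
  let ?T = "{t. t < d \<and> g t \<noteq> g (t + 1)}"
  have card_T: "card ?T = sign_changes d f"
    unfolding sign_changes_def g_def by simp
  obtain P where P: "P \<in> polys_in d" "pdegree P \<le> card ?T"
    "\<And>u. peval P u = g 0 * (\<Prod>t\<in>?T. real t + 1 / 2 - neg_count d u)"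
    using exists_poly_prod_minus_neg_count[of ?T d "g 0" "\<lambda>t. real t + 1 / 2"] by auto
  have sgn_P: "sgn (peval P u) = f u" if u: "u \<in> cube d" for u
  proof -
    obtain A where A: "A \<subseteq> {..<d}" "u = vertex d A"
      using u by (rule cube_eq_vertex)
    have "card A \<le> d" using card_mono[OF _ A(1)] by simp
    then have "sgn (peval P u) = g (card A)"
      using sgn_prod_half_integers[of d g "card A"] profile_values[OF f] A
      by (simp add: P(3) neg_count_vertex g_def)
    then show ?thesis
      using profile_vertex[OF f A(1)] A(2) by (simp add: g_def)
  qed
  have "peval P u \<noteq> 0" if "u \<in> cube d" for u
    using sgn_P[OF that] f(1) that by force
  then have "sign_represents d P f"
    unfolding sign_represents_def using P(1) sgn_P by force
  then show ?thesis
    using that P(2) card_T by simp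
qed

theorem theorem3p52:
  fixes d :: nat and f :: "(nat \<Rightarrow> real) \<Rightarrow> real"
  assumes "f \<in> cube d \<rightarrow> {-1, 1}"
    and "symmetric_on_cube d f"
  shows "thrdeg d f = sign_changes d f"
proof -
  obtain P where P: "sign_represents d P f" "pdegree P \<le> sign_changes d f"
    using exists_sign_represents[OF assms] .
  show ?thesis
    unfolding thrdeg_def
  proof (rule Least_equality)
    show "\<exists>P. sign_represents d P f \<and> pdegree P = sign_changes d f"
      using P sign_changes_le_pdegree[OF assms P(1)] le_antisym by blast
  qed (use sign_changes_le_pdegree[OF assms] in blast)
qed

end
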